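(* Let $T,C_1,\kappa_1,\kappa_2,k\ge 1$ and $C_2^{(1)},C_2^{(2)},C_2^{(3)}\ge 1$ be integers, and let $X,Y:\mathcal{C}_3\to\mathbf{Vect}$ be the data functor and feature functor defined in the context, where $\mathcal{C}_3=\mathbf{B}(C_T\times\Lambda)\times P$. Let $\eta=(\eta_{(\star,s)}:X(\star,s)\to Y(\star,s))_{s\in P}$ be the linear core defined in the context, built from Stage-1 kernels $W_{\mathrm{ax}}\in\mathbb{R}^{C_1\times\kappa_1}$, Stage-2 kernels $W_d\in\mathbb{R}^{C_2^{(d)}\times C_1\times \kappa_2}$ ($d\in\{1,2,3\}$) and the $k$-tap circular box smoother $\mathrm{Box}^{\circlearrowleft}_k$, so that: (i) all temporal convolutions use circular padding (time indices modulo $T$); (ii) Stage 1 is depthwise in the axis index (no cross-axis mixing); (iii) the linear core is block-diagonal in the decomposition into sensors (no cross-sensor mixing). Then for every $(\tau,\lambda)\in C_T\times\Lambda$ and every morphism $u:s\to t$ of $P$, $$Y\big((\tau,\lambda),u\big)\circ\eta_{(\star,s)}=\eta_{(\star,t)}\circ X\big((\tau,\lambda),u\big),$$ i.e. $\eta$ is a natural transformation $\eta:X\Rightarrow Y$ between functors $\mathcal{C}_3\to\mathbf{Vect}$. (Moreover, the box smoother commutes with the mean over sensors: for all $H_{\mathrm{ACC}},H_{\mathrm{GYR}}\in\mathbb{R}^{N\times T}$, $N\geq 1$, $\mathrm{Box}^{\circlearrowleft}_k\big(\tfrac12(H_{\mathrm{ACC}}+H_{\mathrm{GYR}})\big)=\tfrac12\big(\mathrm{Box}^{\circlearrowleft}_k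 H_{\mathrm{ACC}}+\mathrm{Box}^{\circlearrowleft}_k H_{\mathrm{GYR}}\big)$, so applying the smoother before or after the sensor mean gives the same output after averaging over time.)
   Context: $\mathbf{Vect}$ is the category of finite-dimensional real vector spaces and linear maps. **Symmetry category.** $C_T=\mathbb{Z}/T\mathbb{Z}$; $\Lambda=\mathbb{R}_{>0}^{\{\mathrm{ACC},\mathrm{GYR}\}}$ is a group under componentwise multiplication. $\mathbf{B}(C_T\times\Lambda)$ is the one-object category with object $\star$, morphisms $(\tau,\lambda)\in C_T\times\Lambda$, and composition $(\tau_2,\lambda_2)\circ(\tau_1,\lambda_1)=(\tau_2+\tau_1,\lambda_2\lambda_1)$. $P$ is the poset, regarded as a thin category (a unique morphism $s\to t$ iff $s\preceq t$), with the nine elements $\mathrm{ACC}_\alpha,\mathrm{GYR}_\alpha$ ($\alpha\in\{x,y,z\}$), $\mathrm{ACC}$, $\mathrm{GYR}$, $\mathrm{TOTAL}$, and order generated by $\mathrm{ACC}_\alpha\prec\mathrm{ACC}\prec\mathrm{TOTAL}$ and $\mathrm{GYR}_\alpha\prec\mathrm{GYR}\prec\mathrm{TOTAL}$. $\mathcal{C}_3=\mathbf{B}(C_T\times\Lambda)\times P$ is the product category. **Data functor $X$.** For $s\in P$ let $A_s$ be the set of axis channels below $s$: $A_{\mathrm{ACC}_\alpha}=\{(\mathrm{ACC},\alpha)\}$, $A_{\mathrm{GYR}_\alpha}=\{(\mathrm{GYR},\alpha)\}$, $A_{\mathrm{ACC}}=\{\mathrm{ACC}\}\times\{x,y,z\}$,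 $A_{\mathrm{GYR}}=\{\mathrm{GYR}\}\times\{x,y,z\}$, $A_{\mathrm{TOTAL}}=A_{\mathrm{ACC}}\cup A_{\mathrm{GYR}}$. Put $X(\star,s)=\prod_{(q,\alpha)\in A_s}\mathbb{R}^T$ (so $X(\star,s)$ is $\mathbb{R}^T$, $\mathbb{R}^{3\times T}$ or $\mathbb{R}^{6\times T}$ for an axis, a sensor, or TOTAL). The time–gain action is the linear map $S^{(s)}_{(\tau,\lambda)}$ on $X(\star,s)$, $$(S^{(s)}_{(\tau,\lambda)}x)_{q,\alpha}(t)=\lambda_q\,x_{q,\alpha}(t-\tau \bmod T),\qquad (q,\alpha)\in A_s .$$ For $u:s\to t$ in $P$ (so $A_s\subseteq A_t$), $J_u:X(\star,s)\to X(\star,t)$ is the canonical injection, i.e. extension by zero on channels in $A_t\setminus A_s$. On morphisms $X((\tau,\lambda),u)=J_u\circ S^{(s)}_{(\tau,\lambda)}=S^{(t)}_{(\tau,\lambda)}\circ J_u$. **Feature functor $Y$.** Let $C=C_2^{(1)}+C_2^{(2)}+C_2^{(3)}$ and $Y(\star,s)=\prod_{(q,\alpha)\in A_s}\mathbb{R}^{C\times T}$; the maps $S^{(s)}_{(\tau,\lambda)}$, $J_u$ and $Y((\tau,\lambda),u)=J_u\circ S^{(s)}_{(\tau,\lambda)}$ are given by the same formulas (the shift acts on time, $\lambda_q$ multiplies every feature channel of the block $(q,\alpha)$). **Linear core $\eta$.** It is the linear network without biases, nonlinearities, normalizations, axis pooling, sensor averaging or time averaging, obtained as follows. All time indices are modulo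 $T$. - Stage 1 (circular convolution, the same kernel bank for each axis channel): $v\in\mathbb{R}^T\mapsto h\in\mathbb{R}^{C_1\times T}$, $h_c(t)=\sum_{j=0}^{\kappa_1-1}W_{\mathrm{ax}}(c,j)\,v(t-j)$. - Stage 2, branch $d\in\{1,2,3\}$ (circular convolution with dilation $d$, the same kernel bank for each sensor, and acting on each axis block separately since the axis pooling is omitted): $h\in\mathbb{R}^{C_1\times T}\mapsto h^{(d)}\in\mathbb{R}^{C_2^{(d)}\times T}$, $h^{(d)}_e(t)=\sum_{c=1}^{C_1}\sum_{j=0}^{\kappa_2-1}W_d(e,c,j)\,h_c(t-dj)$. - Smoothing: $\mathrm{Box}^{\circlearrowleft}_k$ acts on each channel $f\in\mathbb{R}^T$ separately by the circular $k$-tap average $(\mathrm{Box}^{\circlearrowleft}_kf)(t)=\frac1k\sum_{j=0}^{k-1}f(t-j)$. Let $E:\mathbb{R}^T\to\mathbb{R}^{C\times T}$ be the linear map sending $v$ to the concatenation over $d=1,2,3$ of $\mathrm{Box}^{\circlearrowleft}_k(h^{(d)})$. Then $(\eta_{(\star,s)}x)_{q,\alpha}=E(x_{q,\alpha})$ for $(q,\alpha)\in A_s$. *)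

theory Defs
  imports
    "HOL-Algebra.Elementary_Groups"
    "Jordan_Normal_Form.VS_Connect"
begin

section \<open>Categories, functors, natural transformations\<close>

record ('o, 'm) category =
  Ob   :: "'o set"
  Arr  :: "'m set"
  Dom  :: "'m \<Rightarrow> 'o"
  Cod  :: "'m \<Rightarrow> 'o"
  Idt  :: "'o \<Rightarrow> 'm"
  Cmp  :: "'m \<Rightarrow> 'm \<Rightarrow> 'm"  (infixl \<open>\<cdot>\<index>\<close> 70)

locale category =
  fixes C :: "('o, 'm) category"  (structure)
  assumes Dom_closed: "f \<in> Arr C \<Longrightarrow> Dom C f \<in> Ob C"
    and Cod_closed: "f \<in> Arr C \<Longrightarrow> Cod C f \<in> Ob C"
    and Idt_Arr: "a \<in> Ob C \<Longrightarrow> Idt C a \<in> Arr C"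
    and Dom_Idt: "a \<in> Ob C \<Longrightarrow> Dom C (Idt C a) = a"
    and Cod_Idt: "a \<in> Ob C \<Longrightarrow> Cod C (Idt C a) = a"
    and Cmp_Arr: "\<lbrakk>f \<in> Arr C; g \<in> Arr C; Dom C g = Cod C f\<rbrakk> \<Longrightarrow> g \<cdot> f \<in> Arr C"
    and Dom_Cmp: "\<lbrakk>f \<in> Arr C; g \<in> Arr C; Dom C g = Cod C f\<rbrakk> \<Longrightarrow> Dom C (g \<cdot> f) = Dom C f"
    and Cod_Cmp: "\<lbrakk>f \<in> Arr C; g \<in> Arr C; Dom C g = Cod C f\<rbrakk> \<Longrightarrow> Cod C (g \<cdot> f) = Cod C g"
    and Idt_left: "f \<in> Arr C \<Longrightarrow> Idt C (Cod C f) \<cdot> f = f"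
    and Idt_right: "f \<in> Arr C \<Longrightarrow> f \<cdot> Idt C (Dom C f) = f"
    and Cmp_assoc: "\<lbrakk>f \<in> Arr C; g \<in> Arr C; h \<in> Arr C; Dom C g = Cod C f; Dom C h = Cod C g\<rbrakk>
      \<Longrightarrow> (h \<cdot> g) \<cdot> f = h \<cdot> (g \<cdot> f)"

record ('o, 'm, 'p, 'n) functor_data =
  obj_map :: "'o \<Rightarrow> 'p"
  arr_map :: "'m \<Rightarrow> 'n"

locale cat_functor = source: category C + target: category D
  for C :: "('o, 'm) category" and D :: "('p, 'n) category" +
  fixes F :: "('o, 'm, 'p, 'n) functor_data"
  assumes obj_map_closed: "a \<in> Ob C \<Longrightarrow> obj_map F a \<in> Ob D"
    and arr_map_closed: "f \<in> Arr C \<Longrightarrow> arr_map F f \<in> Arr D"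
    and Dom_arr_map: "f \<in> Arr C \<Longrightarrow> Dom D (arr_map F f) = obj_map F (Dom C f)"
    and Cod_arr_map: "f \<in> Arr C \<Longrightarrow> Cod D (arr_map F f) = obj_map F (Cod C f)"
    and arr_map_Idt: "a \<in> Ob C \<Longrightarrow> arr_map F (Idt C a) = Idt D (obj_map F a)"
    and arr_map_Cmp: "\<lbrakk>f \<in> Arr C; g \<in> Arr C; Dom C g = Cod C f\<rbrakk>
      \<Longrightarrow> arr_map F (g \<cdot>\<^bsub>C\<^esub> f) = arr_map F g \<cdot>\<^bsub>D\<^esub> arr_map F f"

locale natural_transformation = F: cat_functor C D F + G: cat_functor C D G
  for C :: "('o, 'm) category" and D :: "('p, 'n) category"
    and F G :: "('o, 'm, 'p, 'n) functor_data" +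
  fixes \<eta> :: "'o \<Rightarrow> 'n"
  assumes component_Arr: "a \<in> Ob C \<Longrightarrow> \<eta> a \<in> Arr D"
    and Dom_component: "a \<in> Ob C \<Longrightarrow> Dom D (\<eta> a) = obj_map F a"
    and Cod_component: "a \<in> Ob C \<Longrightarrow> Cod D (\<eta> a) = obj_map G a"
    and naturality: "f \<in> Arr C
      \<Longrightarrow> arr_map G f \<cdot>\<^bsub>D\<^esub> \<eta> (Dom C f) = \<eta> (Cod C f) \<cdot>\<^bsub>D\<^esub> arr_map F f"

definition monoid_cat :: "'g monoid \<Rightarrow> (unit, 'g) category" where
  "monoid_cat G =
    \<lparr>Ob = UNIV, Arr = carrier G, Dom = (\<lambda>_. ()), Cod = (\<lambda>_. ()),
     Idt = (\<lambda>_. \<one>\<^bsub>G\<^esub>), Cmp = (\<lambda>g f. g \<otimes>\<^bsub>G\<^esub> f)\<rparr>"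

text \<open>The unique arrow from \<open>s\<close> to \<open>t\<close> in a thin category is the pair \<open>(s, t)\<close>.\<close>

definition thin_cat :: "('a \<Rightarrow> 'a \<Rightarrow> bool) \<Rightarrow> ('a, 'a \<times> 'a) category" where
  "thin_cat R =
    \<lparr>Ob = UNIV, Arr = {(s, t). R s t}, Dom = fst, Cod = snd,
     Idt = (\<lambda>s. (s, s)), Cmp = (\<lambda>v u. (fst u, snd v))\<rparr>"

definition prod_cat ::
    "('o, 'm) category \<Rightarrow> ('p, 'n) category \<Rightarrow> ('o \<times> 'p, 'm \<times> 'n) category" where
  "prod_cat C D =
    \<lparr>Ob = Ob C \<times> Ob D, Arr = Arr C \<times> Arr D,
     Dom = map_prod (Dom C) (Dom D), Cod = map_prod (Cod C) (Cod D),
     Idt = map_prod (Idt C) (Idt D),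
     Cmp = (\<lambda>(g, g') (f, f'). (g \<cdot>\<^bsub>C\<^esub> f, g' \<cdot>\<^bsub>D\<^esub> f'))\<rparr>"


section \<open>The category of finite-dimensional real vector spaces\<close>

abbreviation real_field :: "real ring" where
  "real_field \<equiv> class_ring"

text \<open>
  An arrow \<open>(V, f, W)\<close> carries its domain and codomain; requiring \<open>f\<close> to be extensional
  makes equality of arrows coincide with equality of maps on the carrier of \<open>V\<close>.
  The underlying sets of the spaces range over the subsets of one type \<open>'v\<close>.
\<close>

type_synonym 'v linear_arrow = "(real, 'v) module \<times> ('v \<Rightarrow> 'v) \<times> (real, 'v) module"

definition fd_spaces :: "(real, 'v) module set" where
  "fd_spaces = {V. vectorspace real_field V \<and> vectorspace.fin_dim real_field V}"

definition Vect :: "((real, 'v) module, 'v linear_arrow) category" where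
  "Vect =
    \<lparr>Ob = fd_spaces,
     Arr = {(V, f, W). V \<in> fd_spaces \<and> W \<in> fd_spaces
              \<and> linear_map real_field V W f \<and> f \<in> extensional (carrier V)},
     Dom = (\<lambda>(V, f, W). V),
     Cod = (\<lambda>(V, f, W). W),
     Idt = (\<lambda>V. (V, (\<lambda>x\<in>carrier V. x), V)),
     Cmp = (\<lambda>(V', g, W') (V, f, W). (V, compose (carrier V) g f, W'))\<rparr>"


section \<open>The symmetry category\<close>

datatype sensor = ACC | GYR
datatype axis = X_axis | Y_axis | Z_axis
type_synonym channel = "sensor \<times> axis"

datatype node = Axis sensor axis | Sensor sensor | TOTAL

inductive node_step :: "node \<Rightarrow> node \<Rightarrow> bool" where
  "node_step (Axis q \<alpha>) (Sensor q)"
| "node_step (Sensor q) TOTAL"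

definition node_le :: "node \<Rightarrow> node \<Rightarrow> bool" where
  "node_le = node_step\<^sup>*\<^sup>*"

definition gain_group :: "(sensor \<Rightarrow> real) monoid" where
  "gain_group =
    \<lparr>carrier = {g. \<forall>q. g q > 0}, mult = (\<lambda>g h q. g q * h q), one = (\<lambda>_. 1)\<rparr>"

type_synonym sym_arrow = "(int \<times> (sensor \<Rightarrow> real)) \<times> (node \<times> node)"

definition sym_cat :: "nat \<Rightarrow> (unit \<times> node, sym_arrow) category" where
  "sym_cat T = prod_cat (monoid_cat (integer_mod_group T \<times>\<times> gain_group)) (thin_cat node_le)"

fun channels :: "node \<Rightarrow> channel set" where
  "channels (Axis q \<alpha>) = {(q, \<alpha>)}"
| "channels (Sensor q) = {q} \<times> UNIV"
| "channels TOTAL = UNIV"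


section \<open>Data and feature functors\<close>

text \<open>
  A product of copies of \<open>\<real>\<^sup>T\<close> (resp. \<open>\<real>\<^bsup>C \<times> T\<^esup>\<close>) over a set of channels is the space of
  real functions on the set of all its coordinates: \<open>Data ch t\<close> indexes \<open>x\<^bsub>ch\<^esub>(t)\<close> and
  \<open>Feat ch c t\<close> indexes row \<open>c\<close> of the block \<open>ch\<close> at time \<open>t\<close>. One coordinate type for both
  lets data and feature spaces be objects of the same instance of \<^const>\<open>Vect\<close>.
  Times are the residues \<open>{0..<int T}\<close>, the carrier of \<^term>\<open>integer_mod_group T\<close>.
\<close>

datatype coord = Data channel int | Feat channel nat int

type_synonym vec = "coord \<Rightarrow> real"

definition data_coords :: "nat \<Rightarrow> node \<Rightarrow> coord set" where
  "data_coords T s = {Data ch t | ch t. ch \<in> channels s \<and> t \<in> {0..<int T}}"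

definition feat_coords :: "nat \<Rightarrow> nat \<Rightarrow> node \<Rightarrow> coord set" where
  "feat_coords T C s =
    {Feat ch c t | ch c t. ch \<in> channels s \<and> c < C \<and> t \<in> {0..<int T}}"

abbreviation coord_space :: "coord set \<Rightarrow> (real, vec) module" where
  "coord_space I \<equiv> ring.func_space real_field I"

fun coord_sensor :: "coord \<Rightarrow> sensor" where
  "coord_sensor (Data ch t) = fst ch"
| "coord_sensor (Feat ch c t) = fst ch"

fun delay_coord :: "nat \<Rightarrow> int \<Rightarrow> coord \<Rightarrow> coord" where
  "delay_coord T \<tau> (Data ch t) = Data ch ((t - \<tau>) mod int T)"
| "delay_coord T \<tau> (Feat ch c t) = Feat ch c ((t - \<tau>) mod int T)"

definition time_gain :: "nat \<Rightarrow> coord set \<Rightarrow> int \<times> (sensor \<Rightarrow> real) \<Rightarrow> vec \<Rightarrow> vec" where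
  "time_gain T I = (\<lambda>(\<tau>, g) x. \<lambda>i\<in>I. g (coord_sensor i) * x (delay_coord T \<tau> i))"

definition extend_zero :: "coord set \<Rightarrow> coord set \<Rightarrow> vec \<Rightarrow> vec" where
  "extend_zero I I' x = (\<lambda>i\<in>I'. if i \<in> I then x i else 0)"

definition block_functor ::
    "nat \<Rightarrow> (node \<Rightarrow> coord set)
      \<Rightarrow> (unit \<times> node, sym_arrow, (real, vec) module, vec linear_arrow) functor_data" where
  "block_functor T I =
    \<lparr>obj_map = (\<lambda>(_, s). coord_space (I s)),
     arr_map = (\<lambda>(a, (s, t)).
       (coord_space (I s),
        compose (carrier (coord_space (I s))) (extend_zero (I s) (I t)) (time_gain T (I s) a),
        coord_space (I t)))\<rparr>"

definition data_functor ::
    "nat \<Rightarrow> (unit \<times> node, sym_arrow, (real, vec) module, vec linear_arrow) functor_data" where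
  "data_functor T = block_functor T (data_coords T)"

definition feature_functor ::
    "nat \<Rightarrow> nat \<Rightarrow> (unit \<times> node, sym_arrow, (real, vec) module, vec linear_arrow) functor_data" where
  "feature_functor T C = block_functor T (feat_coords T C)"


section \<open>The linear core\<close>

text \<open>
  Signals are functions on \<open>int\<close> that are only ever read at residues in \<open>{0..<int T}\<close>;
  families of signals take the row index first.
\<close>

definition stage1 ::
    "nat \<Rightarrow> nat \<Rightarrow> (nat \<Rightarrow> nat \<Rightarrow> real) \<Rightarrow> (int \<Rightarrow> real) \<Rightarrow> nat \<Rightarrow> int \<Rightarrow> real" where
  "stage1 T \<kappa>\<^sub>1 Wax v c t = (\<Sum>j<\<kappa>\<^sub>1. Wax c j * v ((t - int j) mod int T))"

definition stage2 ::
    "nat \<Rightarrow> nat \<Rightarrow> nat \<Rightarrow> nat \<Rightarrow> (nat \<Rightarrow> nat \<Rightarrow> nat \<Rightarrow> real)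
      \<Rightarrow> (nat \<Rightarrow> int \<Rightarrow> real) \<Rightarrow> nat \<Rightarrow> int \<Rightarrow> real" where
  "stage2 T C\<^sub>1 \<kappa>\<^sub>2 d W h e t =
    (\<Sum>c<C\<^sub>1. \<Sum>j<\<kappa>\<^sub>2. W e c j * h c ((t - int d * int j) mod int T))"

definition box_smooth :: "nat \<Rightarrow> nat \<Rightarrow> (int \<Rightarrow> real) \<Rightarrow> int \<Rightarrow> real" where
  "box_smooth T k f t = (1 / real k) * (\<Sum>j<k. f ((t - int j) mod int T))"

definition concat3 :: "(nat \<Rightarrow> nat) \<Rightarrow> (nat \<Rightarrow> nat \<Rightarrow> 'b) \<Rightarrow> nat \<Rightarrow> 'b" where
  "concat3 n H c =
    (if c < n 1 then H 1 c
     else if c < n 1 + n 2 then H 2 (c - n 1)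
     else H 3 (c - (n 1 + n 2)))"

definition encoder ::
    "nat \<Rightarrow> nat \<Rightarrow> nat \<Rightarrow> nat \<Rightarrow> nat \<Rightarrow> (nat \<Rightarrow> nat)
      \<Rightarrow> (nat \<Rightarrow> nat \<Rightarrow> real) \<Rightarrow> (nat \<Rightarrow> nat \<Rightarrow> nat \<Rightarrow> nat \<Rightarrow> real)
      \<Rightarrow> (int \<Rightarrow> real) \<Rightarrow> nat \<Rightarrow> int \<Rightarrow> real" where
  "encoder T C\<^sub>1 \<kappa>\<^sub>1 \<kappa>\<^sub>2 k C\<^sub>2 Wax W v =
    concat3 C\<^sub>2 (\<lambda>d e. box_smooth T k (stage2 T C\<^sub>1 \<kappa>\<^sub>2 d (W d) (stage1 T \<kappa>\<^sub>1 Wax v) e))"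

definition feature_count :: "(nat \<Rightarrow> nat) \<Rightarrow> nat" where
  "feature_count C\<^sub>2 = C\<^sub>2 1 + C\<^sub>2 2 + C\<^sub>2 3"

text \<open>
  Only the values at \<open>Feat\<close> coordinates matter: \<^const>\<open>feat_coords\<close> contains no others.
\<close>

fun apply_blockwise :: "((int \<Rightarrow> real) \<Rightarrow> nat \<Rightarrow> int \<Rightarrow> real) \<Rightarrow> vec \<Rightarrow> vec" where
  "apply_blockwise E x (Feat ch c t) = E (\<lambda>t'. x (Data ch t')) c t"
| "apply_blockwise E x (Data ch t) = undefined"

definition linear_core ::
    "nat \<Rightarrow> nat \<Rightarrow> nat \<Rightarrow> nat \<Rightarrow> nat \<Rightarrow> (nat \<Rightarrow> nat)
      \<Rightarrow> (nat \<Rightarrow> nat \<Rightarrow> real) \<Rightarrow> (nat \<Rightarrow> nat \<Rightarrow> nat \<Rightarrow> nat \<Rightarrow> real)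
      \<Rightarrow> unit \<times> node \<Rightarrow> vec linear_arrow" where
  "linear_core T C\<^sub>1 \<kappa>\<^sub>1 \<kappa>\<^sub>2 k C\<^sub>2 Wax W = (\<lambda>(_, s).
    let V = coord_space (data_coords T s); I = feat_coords T (feature_count C\<^sub>2) s
    in (V,
        \<lambda>x\<in>carrier V. \<lambda>i\<in>I. apply_blockwise (encoder T C\<^sub>1 \<kappa>\<^sub>1 \<kappa>\<^sub>2 k C\<^sub>2 Wax W) x i,
        coord_space I))"


section \<open>Smoothing and averaging of matrices\<close>

definition matrices :: "nat \<Rightarrow> nat \<Rightarrow> (nat \<Rightarrow> int \<Rightarrow> real) set" where
  "matrices N T = {..<N} \<rightarrow>\<^sub>E ({0..<int T} \<rightarrow>\<^sub>E UNIV)"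

definition box_rows :: "nat \<Rightarrow> nat \<Rightarrow> nat \<Rightarrow> (nat \<Rightarrow> int \<Rightarrow> real) \<Rightarrow> nat \<Rightarrow> int \<Rightarrow> real" where
  "box_rows N T k H = (\<lambda>n\<in>{..<N}. \<lambda>t\<in>{0..<int T}. box_smooth T k (H n) t)"

definition sensor_mean ::
    "nat \<Rightarrow> nat \<Rightarrow> (nat \<Rightarrow> int \<Rightarrow> real) \<Rightarrow> (nat \<Rightarrow> int \<Rightarrow> real) \<Rightarrow> nat \<Rightarrow> int \<Rightarrow> real" where
  "sensor_mean N T H H' = (\<lambda>n\<in>{..<N}. \<lambda>t\<in>{0..<int T}. (1 / 2) * (H n t + H' n t))"

definition time_mean :: "nat \<Rightarrow> nat \<Rightarrow> (nat \<Rightarrow> int \<Rightarrow> real) \<Rightarrow> nat \<Rightarrow> real" where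
  "time_mean N T H = (\<lambda>n\<in>{..<N}. (1 / real T) * (\<Sum>t\<in>{0..<int T}. H n t))"

end

theory Submission
  imports Defs
begin

text \<open>
  Every stage of the encoder is a linear combination of cyclic delays, hence commutes with the
  time shifts and, by linearity, with scaling by the gain of the block it acts on. The blocks are
  never mixed, and a zero block is mapped to zero, so extension by zero commutes with it as well.
\<close>

section \<open>Categories\<close>

lemma category_monoid_cat: "monoid G \<Longrightarrow> category (monoid_cat G)"
  by unfold_locales (auto simp: monoid_cat_def monoid.m_assoc monoid.l_one monoid.r_one
      intro: monoid.m_closed monoid.one_closed)

lemma category_thin_cat:
  assumes "reflp R" "transp R"
  shows "category (thin_cat R)"
  using assms
  by unfold_locales (auto simp: thin_cat_def reflp_def dest: transpD)

lemma category_prod_cat: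
  assumes "category C" "category D"
  shows "category (prod_cat C D)"
proof -
  interpret C: category C by fact
  interpret D: category D by fact
  show ?thesis
    by unfold_locales
      (auto simp: prod_cat_def C.Dom_closed C.Cod_closed C.Idt_Arr C.Dom_Idt C.Cod_Idt
        C.Cmp_Arr C.Dom_Cmp C.Cod_Cmp C.Idt_left C.Idt_right C.Cmp_assoc
        D.Dom_closed D.Cod_closed D.Idt_Arr D.Dom_Idt D.Cod_Idt
        D.Cmp_Arr D.Dom_Cmp D.Cod_Cmp D.Idt_left D.Idt_right D.Cmp_assoc)
qed

section \<open>Linear maps and the laws of \<open>Vect\<close>\<close>

lemma linear_map_iff:
  "linear_map K V W f \<longleftrightarrow> vectorspace K V \<and> vectorspace K W \<and> f \<in> LinearCombinations.module_hom K V W"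
  unfolding linear_map_def mod_hom_def mod_hom_axioms_def vectorspace_def by auto

lemma linear_map_id_restrict:
  assumes "vectorspace K V"
  shows "linear_map K V V (\<lambda>x\<in>carrier V. x)"
proof -
  interpret vectorspace K V by fact
  show ?thesis
    using assms by (auto simp: linear_map_iff LinearCombinations.module_hom_def)
qed

text \<open>Restricting the composite to \<open>carrier U\<close> preserves linearity because sums
  and multiples of elements of \<open>carrier U\<close> stay in it.\<close>

lemma linear_map_compose:
  assumes "linear_map K U V f" "linear_map K V W g"
  shows "linear_map K U W (compose (carrier U) g f)"
proof -
  interpret f: linear_map K U V f by fact
  interpret g: linear_map K V W g by fact
  have "compose (carrier U) g f \<in> LinearCombinations.module_hom K U W"
    unfolding LinearCombinations.module_hom_def by (auto simp: compose_def)
  then show ?thesis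
    by (simp add: linear_map_iff f.V.vectorspace_axioms g.W.vectorspace_axioms)
qed

lemma linear_map_closed: "linear_map K V W f \<Longrightarrow> f \<in> carrier V \<rightarrow> carrier W"
  by (simp add: linear_map_iff LinearCombinations.module_hom_def)

lemma category_Vect: "category (Vect :: ((real, 'v) module, 'v linear_arrow) category)"
proof
  fix f :: "'v linear_arrow"
  assume f: "f \<in> Arr Vect"
  \<comment> \<open>Both unit laws are strict equalities of functions: a restricted identity changes
    nothing on the carrier, and off the carrier both sides are \<open>undefined\<close> since
    \<open>f\<close> is extensional.\<close>
  show "Idt Vect (Cod Vect f) \<cdot>\<^bsub>Vect\<^esub> f = f"
    using f by (auto simp: Vect_def dest!: linear_map_closed intro!: Id_compose)
  show "f \<cdot>\<^bsub>Vect\<^esub> Idt Vect (Dom Vect f) = f"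
    using f by (auto simp: Vect_def intro!: compose_Id dest!: linear_map_closed)
next
  fix f g h :: "'v linear_arrow"
  assume "f \<in> Arr Vect" "g \<in> Arr Vect" "h \<in> Arr Vect"
    and "Dom Vect g = Cod Vect f" "Dom Vect h = Cod Vect g"
  then show "h \<cdot>\<^bsub>Vect\<^esub> g \<cdot>\<^bsub>Vect\<^esub> f = h \<cdot>\<^bsub>Vect\<^esub> (g \<cdot>\<^bsub>Vect\<^esub> f)"
    by (auto simp: Vect_def compose_assoc dest!: linear_map_closed)
qed (auto simp: Vect_def fd_spaces_def linear_map_id_restrict linear_map_compose)

section \<open>Spaces of real functions on coordinates\<close>

lemma coord_space_simps [simp]:
  "carrier (coord_space I) = I \<rightarrow>\<^sub>E UNIV"
  "add (coord_space I) = (\<lambda>x y. \<lambda>i\<in>I. x i + y i)"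
  "zero (coord_space I) = (\<lambda>i\<in>I. 0)"
  "module.smult (coord_space I) = (\<lambda>c x. \<lambda>i\<in>I. c * x i)"
  by (simp_all add: class_ring.func_space_def)

lemma vectorspace_coord_space: "vectorspace real_field (coord_space I)"
proof -
  have "cring real_field"
    using class_field.field_axioms by (intro domain.axioms(1) field.axioms(1))
  then show ?thesis
    by (simp add: vectorspace_def class_field.field_axioms cring.func_space_is_module)
qed

text \<open>\<open>fin_dim\<close> asks for a finite spanning set, and the indicator functions
  \<open>e j\<close> of single coordinates form one.\<close>

lemma fin_dim_coord_space:
  assumes "finite I"
  shows "vectorspace.fin_dim real_field (coord_space I)"
proof -
  interpret vectorspace real_field "coord_space I" by (rule vectorspace_coord_space)
  define e :: "coord \<Rightarrow> vec" where "e j = (\<lambda>i\<in>I. if i = j then 1 else 0)" for j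
  have E: "e ` I \<subseteq> carrier (coord_space I)"
    by (auto simp: e_def)
  interpret S: submodule real_field "span (e ` I)" "coord_space I"
    by (rule span_is_submodule[OF E])
  \<comment> \<open>Truncating \<open>x\<close> to \<open>J\<close> inside the fixed index set
    \<open>I\<close> allows induction on \<open>J\<close>: a new coordinate \<open>j\<close>
    contributes exactly the multiple \<open>x j\<close> of \<open>e j\<close>. The case
    \<open>J = I\<close> gives \<open>x\<close> itself.\<close>
  have partial: "(\<lambda>i\<in>I. if i \<in> J then x i else 0) \<in> span (e ` I)"
    if "finite J" "J \<subseteq> I" for J and x :: vec
    using that
  proof (induction J)
    case empty
    show ?case using S.zero_closed by (simp add: restrict_def)
  next
    case (insert j J)
    have "(\<lambda>i\<in>I. if i \<in> insert j J then x i else 0) =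
        (\<lambda>i\<in>I. if i \<in> J then x i else 0) \<oplus>\<^bsub>coord_space I\<^esub> (x j \<odot>\<^bsub>coord_space I\<^esub> e j)"
      using insert.hyps by (auto simp: e_def fun_eq_iff restrict_def)
    moreover have "e j \<in> span (e ` I)"
      using in_own_span[OF E] insert.prems by auto
    moreover have "(\<lambda>i\<in>I. if i \<in> J then x i else 0) \<in> span (e ` I)"
      using insert by blast
    ultimately show ?case
      by (simp only: S.m_closed S.smult_closed class_ring_simps UNIV_I)
  qed
  have "x \<in> span (e ` I)" if "x \<in> carrier (coord_space I)" for x
  proof -
    \<comment> \<open>Extensionality of \<open>x\<close> gives agreement outside \<open>I\<close> as
      well.\<close>
    have "x = (\<lambda>i\<in>I. if i \<in> I then x i else 0)"
      using that by (auto simp: fun_eq_iff restrict_def PiE_def extensional_def)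
    then show ?thesis using partial[OF assms, of x] by simp
  qed
  then have "span (e ` I) = carrier (coord_space I)"
    using S.subset by blast
  then show ?thesis
    unfolding fin_dim_def using E assms by blast
qed

lemma coord_space_in_fd_spaces: "finite I \<Longrightarrow> coord_space I \<in> fd_spaces"
  by (simp add: fd_spaces_def vectorspace_coord_space fin_dim_coord_space del: coord_space_simps)

text \<open>The images are extensional on \<open>J\<close>, so they need only be compared at
  coordinates \<open>j \<in> J\<close>; linearity becomes a pointwise condition.\<close>

lemma linear_map_coord_spaceI:
  assumes "\<And>x. x \<in> I \<rightarrow>\<^sub>E UNIV \<Longrightarrow> f x \<in> J \<rightarrow>\<^sub>E UNIV"
    and "\<And>x y j. \<lbrakk>x \<in> I \<rightarrow>\<^sub>E UNIV; y \<in> I \<rightarrow>\<^sub>E UNIV; j \<in> J\<rbrakk>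
      \<Longrightarrow> f (\<lambda>i\<in>I. x i + y i) j = f x j + f y j"
    and "\<And>c x j. \<lbrakk>x \<in> I \<rightarrow>\<^sub>E UNIV; j \<in> J\<rbrakk> \<Longrightarrow> f (\<lambda>i\<in>I. c * x i) j = c * f x j"
  shows "linear_map real_field (coord_space I) (coord_space J) f"
proof -
  have "f (\<lambda>i\<in>I. x i + y i) = (\<lambda>j\<in>J. f x j + f y j)"
    if "x \<in> I \<rightarrow>\<^sub>E UNIV" "y \<in> I \<rightarrow>\<^sub>E UNIV" for x y
    using that by (intro PiE_ext[where k = J and s = "\<lambda>_. UNIV"])
      (auto intro!: assms(1) simp: assms(2))
  moreover have "f (\<lambda>i\<in>I. c * x i) = (\<lambda>j\<in>J. c * f x j)" if "x \<in> I \<rightarrow>\<^sub>E UNIV" for c x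
    using that by (intro PiE_ext[where k = J and s = "\<lambda>_. UNIV"])
      (auto intro!: assms(1) simp: assms(3))
  ultimately show ?thesis
    using assms(1)
    by (auto simp: linear_map_iff vectorspace_coord_space LinearCombinations.module_hom_def)
qed

section \<open>The symmetry category\<close>

lemma monoid_gain_group: "monoid gain_group"
  by (rule monoidI) (auto simp: gain_group_def mult.assoc)

lemma category_sym_cat: "category (sym_cat T)"
proof -
  have "reflp node_le" "transp node_le"
    by (auto simp: node_le_def reflp_def transp_def)
  then show ?thesis
    unfolding sym_cat_def
    by (intro category_prod_cat category_monoid_cat category_thin_cat DirProd_monoid
        monoid_gain_group group.is_monoid group_integer_mod_group)
qed

text \<open>Lets later proofs handle arrows as explicit tuples without unfolding the product, monoid
  and thin categories.\<close>

lemma sym_cat_simps: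
  "Ob (sym_cat T) = UNIV"
  "((\<tau>, g), (s, t)) \<in> Arr (sym_cat T) \<longleftrightarrow>
    (\<tau>, g) \<in> carrier (integer_mod_group T \<times>\<times> gain_group) \<and> node_le s t"
  "Dom (sym_cat T) ((\<tau>, g), (s, t)) = ((), s)"
  "Cod (sym_cat T) ((\<tau>, g), (s, t)) = ((), t)"
  "Idt (sym_cat T) ((), s) = ((0, \<lambda>_. 1), (s, s))"
  "((\<tau>', g'), (s', t')) \<cdot>\<^bsub>sym_cat T\<^esub> ((\<tau>, g), (s, t)) =
    (((\<tau>' + \<tau>) mod int T, \<lambda>q. g' q * g q), (s, t'))"
  by (auto simp: sym_cat_def prod_cat_def monoid_cat_def thin_cat_def gain_group_def)

lemma finite_channels: "finite (channels s)"
proof -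
  have "finite (UNIV :: sensor set)"
    by (rule finite_subset[of _ "{ACC, GYR}"]) (auto intro: sensor.exhaust)
  moreover have "finite (UNIV :: axis set)"
    by (rule finite_subset[of _ "{X_axis, Y_axis, Z_axis}"]) (auto intro: axis.exhaust)
  ultimately have "finite (UNIV :: channel set)"
    by (rule finite_Prod_UNIV)
  then show ?thesis
    by (rule finite_subset[OF subset_UNIV])
qed

text \<open>The inclusion is read off the two generating steps and propagates along the reflexive
  transitive closure.\<close>

lemma channels_mono:
  assumes "node_le s t"
  shows "channels s \<subseteq> channels t"
  using assms unfolding node_le_def
  by (induction rule: rtranclp_induct) (auto elim!: node_step.cases)

section \<open>Block functors\<close>

text \<open>Reduction modulo \<open>T\<close> may be done at any stage of a sum, so composing shifts
  is addition in \<open>integer_mod_group T\<close>.\<close>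

lemma delay_coord_delay_coord:
  "delay_coord T \<tau> (delay_coord T \<tau>' i) = delay_coord T ((\<tau> + \<tau>') mod int T) i"
  by (cases i) (auto simp: mod_simps algebra_simps)

lemma coord_sensor_delay_coord [simp]: "coord_sensor (delay_coord T \<tau> i) = coord_sensor i"
  by (cases i) auto

text \<open>Collects what data and feature coordinates have in common, so that functoriality is
  proved once for both. In the last assumption, \<open>i \<in> I t\<close> ensures in both instances
  that the time of \<open>i\<close> is a residue; whether \<open>i\<close> or its delay lies in
  \<open>I s\<close> then depends only on its channel.\<close>

locale time_blocks =
  fixes T :: nat and I :: "node \<Rightarrow> coord set"
  assumes finite_coords: "finite (I s)"
    and coords_mono: "node_le s t \<Longrightarrow> I s \<subseteq> I t"
    and delay_coord_0: "i \<in> I s \<Longrightarrow> delay_coord T 0 i = i"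
    and delay_coord_mem_iff: "i \<in> I t \<Longrightarrow> delay_coord T \<tau> i \<in> I s \<longleftrightarrow> i \<in> I s"
begin

text \<open>Gain, delay and zero extension merge into one case distinction per coordinate, the form
  used in all later computations.\<close>

lemma arr_map_block_functor:
  assumes "node_le s t"
  shows "arr_map (block_functor T I) ((\<tau>, g), (s, t)) =
    (coord_space (I s),
     \<lambda>x\<in>carrier (coord_space (I s)). \<lambda>i\<in>I t.
       if i \<in> I s then g (coord_sensor i) * x (delay_coord T \<tau> i) else 0,
     coord_space (I t))"
  using coords_mono[OF assms]
  by (auto simp: block_functor_def extend_zero_def time_gain_def compose_def fun_eq_iff
      restrict_def)

lemma arr_map_block_functor_in_Arr:
  assumes "node_le s t"
  shows "arr_map (block_functor T I) ((\<tau>, g), (s, t)) \<in> Arr Vect"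
proof -
  have "linear_map real_field (coord_space (I s)) (coord_space (I t))
      (\<lambda>x\<in>carrier (coord_space (I s)). \<lambda>i\<in>I t.
        if i \<in> I s then g (coord_sensor i) * x (delay_coord T \<tau> i) else 0)"
    \<comment> \<open>Each output coordinate is zero or a multiple of one input coordinate;
      \<open>delay_coord_mem_iff\<close> keeps that input coordinate in \<open>I s\<close>, where
      restricted sums have their proper values.\<close>
    by (rule linear_map_coord_spaceI) (auto simp: delay_coord_mem_iff algebra_simps)
  then show ?thesis
    unfolding arr_map_block_functor[OF assms]
    by (simp add: Vect_def coord_space_in_fd_spaces finite_coords del: coord_space_simps)
qed

lemma cat_functor_block_functor: "cat_functor (sym_cat T) Vect (block_functor T I)"
proof (intro cat_functor.intro category_sym_cat category_Vect cat_functor_axioms.intro)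
  fix a :: "unit \<times> node"
  show "obj_map (block_functor T I) a \<in> Ob Vect"
    by (cases a)
      (simp add: block_functor_def Vect_def coord_space_in_fd_spaces finite_coords
        del: coord_space_simps)
  obtain s where a: "a = ((), s)" by (cases a) auto
  have "node_le s s" by (simp add: node_le_def)
  \<comment> \<open>Delay 0 fixes every coordinate of \<open>I s\<close> and the unit gain is 1, so
    what remains is \<open>x\<close> by extensionality.\<close>
  then show "arr_map (block_functor T I) (Idt (sym_cat T) a) =
      Idt Vect (obj_map (block_functor T I) a)"
    unfolding a sym_cat_simps arr_map_block_functor[OF \<open>node_le s s\<close>]
    by (auto simp: block_functor_def Vect_def fun_eq_iff restrict_def
        delay_coord_0 PiE_def extensional_def)
next
  fix f assume f: "f \<in> Arr (sym_cat T)"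
  obtain \<tau> g s t where f_eq: "f = ((\<tau>, g), (s, t))" by (metis surj_pair)
  have "node_le s t" using f by (simp add: f_eq sym_cat_simps)
  note arr = this arr_map_block_functor_in_Arr[OF this, of \<tau> g]
  show "arr_map (block_functor T I) f \<in> Arr Vect"
    using arr by (simp add: f_eq)
  show "Dom Vect (arr_map (block_functor T I) f) =
      obj_map (block_functor T I) (Dom (sym_cat T) f)"
    and "Cod Vect (arr_map (block_functor T I) f) =
      obj_map (block_functor T I) (Cod (sym_cat T) f)"
    by (auto simp: f_eq sym_cat_simps block_functor_def Vect_def)
next
  fix f f' assume f: "f \<in> Arr (sym_cat T)" "f' \<in> Arr (sym_cat T)"
    and comp: "Dom (sym_cat T) f' = Cod (sym_cat T) f"
  obtain \<tau> g s t where f_eq: "f = ((\<tau>, g), (s, t))" by (metis surj_pair)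
  obtain \<tau>' g' t' r where "f' = ((\<tau>', g'), (t', r))" by (metis surj_pair)
  with comp have f'_eq: "f' = ((\<tau>', g'), (t, r))" by (simp add: f_eq sym_cat_simps)
  have le: "node_le s t" "node_le t r"
    using f by (auto simp: f_eq f'_eq sym_cat_simps)
  then have "node_le s r" by (auto simp: node_le_def)
  \<comment> \<open>A coordinate in \<open>I s\<close> also lies in \<open>I t\<close>, so both
    gains and both delays act on it. Outside \<open>I s\<close> both sides vanish, since delays do
    not change membership.\<close>
  with le show "arr_map (block_functor T I) (f' \<cdot>\<^bsub>sym_cat T\<^esub> f) =
      arr_map (block_functor T I) f' \<cdot>\<^bsub>Vect\<^esub> arr_map (block_functor T I) f"
    unfolding f_eq f'_eq sym_cat_simps
    using coords_mono[OF le(1)]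
    by (auto simp: arr_map_block_functor Vect_def compose_def fun_eq_iff restrict_def
        delay_coord_mem_iff delay_coord_delay_coord add.commute)
qed

end

section \<open>The coordinate sets of data and features\<close>

lemma Data_mem_data_coords [simp]:
  "Data ch t \<in> data_coords T s \<longleftrightarrow> ch \<in> channels s \<and> t \<in> {0..<int T}"
  by (cases ch) (simp add: data_coords_def)

text \<open>For \<open>T \<ge> 1\<close> a delayed time is again a residue and the channel is
  untouched, which gives stability under delays.\<close>

lemma time_blocks_data_coords:
  assumes "T \<ge> 1"
  shows "time_blocks T (data_coords T)"
proof
  fix s
  have "data_coords T s = (\<lambda>(ch, t). Data ch t) ` (channels s \<times> {0..<int T})"
    by (auto simp: data_coords_def)
  then show "finite (data_coords T s)" by (simp add: finite_channels)
qed (use assms in \<open>auto simp: data_coords_def dest: subsetD[OF channels_mono]\<close>)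

lemma time_blocks_feat_coords:
  assumes "T \<ge> 1"
  shows "time_blocks T (feat_coords T C)"
proof
  fix s
  have "feat_coords T C s =
      (\<lambda>(ch, c, t). Feat ch c t) ` (channels s \<times> {..<C} \<times> {0..<int T})"
    by (force simp: feat_coords_def)
  then show "finite (feat_coords T C s)" by (simp add: finite_channels)
qed (use assms in \<open>auto simp: feat_coords_def dest: subsetD[OF channels_mono]\<close>)

section \<open>Shift-equivariant linear operators\<close>

text \<open>
  Additivity, homogeneity, commutation with the cyclic shifts and dependence on the values at
  residues only, rolled into one property that is closed under composition.
\<close>

definition shift_equivariant :: "nat \<Rightarrow> ((int \<Rightarrow> real) \<Rightarrow> int \<Rightarrow> real) \<Rightarrow> bool" where
  "shift_equivariant T A \<longleftrightarrow>
    (\<forall>u v w a b \<tau>.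
      (\<forall>t. u (t mod int T) = a * v ((t - \<tau>) mod int T) + b * w ((t - \<tau>) mod int T)) \<longrightarrow>
      (\<forall>t. A u (t mod int T) = a * A v ((t - \<tau>) mod int T) + b * A w ((t - \<tau>) mod int T)))"

text \<open>Premise and conclusion of the defining implication have the same shape: the conclusion
  for \<open>B\<close> is the premise for \<open>A\<close>, with the same \<open>a\<close>,
  \<open>b\<close> and \<open>\<tau>\<close>.\<close>

lemma shift_equivariant_compose:
  "shift_equivariant T A \<Longrightarrow> shift_equivariant T B \<Longrightarrow> shift_equivariant T (\<lambda>v. A (B v))"
  unfolding shift_equivariant_def by blast

lemma shift_equivariant_delay: "shift_equivariant T (\<lambda>v t. v ((t - d) mod int T))"
  unfolding shift_equivariant_def
proof (intro allI impI)
  fix u v w :: "int \<Rightarrow> real" and a b \<tau> t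
  assume "\<forall>t. u (t mod int T) = a * v ((t - \<tau>) mod int T) + b * w ((t - \<tau>) mod int T)"
  \<comment> \<open>Delaying by \<open>d\<close> commutes with delaying by \<tau>, so the relation
    at time \<open>t - d\<close> is the one wanted.\<close>
  from this[rule_format, of "t - d"]
  show "u ((t mod int T - d) mod int T) = a * v (((t - \<tau>) mod int T - d) mod int T) +
      b * w (((t - \<tau>) mod int T - d) mod int T)"
    by (simp add: mod_simps algebra_simps)
qed

lemma shift_equivariant_scale:
  assumes "shift_equivariant T A"
  shows "shift_equivariant T (\<lambda>v t. c * A v t)"
  unfolding shift_equivariant_def
proof (intro allI impI)
  fix u v w :: "int \<Rightarrow> real" and a b \<tau> t
  assume "\<forall>t. u (t mod int T) = a * v ((t - \<tau>) mod int T) + b * w ((t - \<tau>) mod int T)"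
  then have "A u (t mod int T) = a * A v ((t - \<tau>) mod int T) + b * A w ((t - \<tau>) mod int T)"
    using assms unfolding shift_equivariant_def by blast
  then show "c * A u (t mod int T) =
      a * (c * A v ((t - \<tau>) mod int T)) + b * (c * A w ((t - \<tau>) mod int T))"
    by (simp add: algebra_simps)
qed

lemma shift_equivariant_sum:
  assumes "\<And>j. j \<in> J \<Longrightarrow> shift_equivariant T (A j)"
  shows "shift_equivariant T (\<lambda>v t. \<Sum>j\<in>J. A j v t)"
  unfolding shift_equivariant_def
proof (intro allI impI)
  fix u v w :: "int \<Rightarrow> real" and a b \<tau> t
  assume "\<forall>t. u (t mod int T) = a * v ((t - \<tau>) mod int T) + b * w ((t - \<tau>) mod int T)"
  then have "A j u (t mod int T) =
      a * A j v ((t - \<tau>) mod int T) + b * A j w ((t - \<tau>) mod int T)" if "j \<in> J" for j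
    using assms[OF that] unfolding shift_equivariant_def by blast
  then show "(\<Sum>j\<in>J. A j u (t mod int T)) =
      a * (\<Sum>j\<in>J. A j v ((t - \<tau>) mod int T)) + b * (\<Sum>j\<in>J. A j w ((t - \<tau>) mod int T))"
    by (simp add: sum.distrib sum_distrib_left)
qed

section \<open>Equivariance of the stages\<close>

lemma shift_equivariant_stage1: "shift_equivariant T (\<lambda>v. stage1 T \<kappa> Wax v c)"
  unfolding stage1_def
  by (intro shift_equivariant_sum shift_equivariant_scale shift_equivariant_delay)

text \<open>Stage 2 mixes several rows, so it is not an operator on one signal. The rows are
  therefore taken as a family of operators on a common input \<open>v\<close>, each followed by a
  delay.\<close>

lemma shift_equivariant_stage2:
  assumes "\<And>c. shift_equivariant T (\<lambda>v. H v c)"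
  shows "shift_equivariant T (\<lambda>v. stage2 T C \<kappa> d W (H v) e)"
  unfolding stage2_def
  by (intro shift_equivariant_sum shift_equivariant_scale
      shift_equivariant_compose[OF shift_equivariant_delay] assms)

lemma shift_equivariant_box_smooth: "shift_equivariant T (box_smooth T k)"
  unfolding box_smooth_def
  by (intro shift_equivariant_sum shift_equivariant_scale shift_equivariant_delay)

text \<open>Each row of the concatenation is a row of one branch, and a branch is a composition of
  equivariant operators.\<close>

lemma shift_equivariant_encoder:
  "shift_equivariant T (\<lambda>v. encoder T C\<^sub>1 \<kappa>\<^sub>1 \<kappa>\<^sub>2 k C\<^sub>2 Wax W v c)"
proof -
  have "shift_equivariant T
      (\<lambda>v. box_smooth T k (stage2 T C\<^sub>1 \<kappa>\<^sub>2 d (W d) (stage1 T \<kappa>\<^sub>1 Wax v) e))" for d e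
    by (intro shift_equivariant_compose[OF shift_equivariant_box_smooth]
        shift_equivariant_stage2 shift_equivariant_stage1)
  then show ?thesis
    by (cases "c < C\<^sub>2 1"; cases "c < C\<^sub>2 1 + C\<^sub>2 2")
      (simp_all add: encoder_def concat3_def del: One_nat_def)
qed

text \<open>Form suited to coordinate spaces, where the relation between signals is known at
  residues only.\<close>

lemma shift_equivariantD:
  assumes A: "shift_equivariant T A" and t: "t \<in> {0..<int T}"
    and u: "\<And>t. t \<in> {0..<int T} \<Longrightarrow>
      u t = a * v ((t - \<tau>) mod int T) + b * w ((t - \<tau>) mod int T)"
  shows "A u t = a * A v ((t - \<tau>) mod int T) + b * A w ((t - \<tau>) mod int T)"
proof -
  \<comment> \<open>The residue \<open>t\<close> forces \<open>T > 0\<close>, so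
    \<open>r mod int T\<close> is a residue too.\<close>
  have "u (r mod int T) = a * v ((r - \<tau>) mod int T) + b * w ((r - \<tau>) mod int T)" for r
    using t u[of "r mod int T"] by (simp add: mod_simps)
  then have "A u (t mod int T) = a * A v ((t - \<tau>) mod int T) + b * A w ((t - \<tau>) mod int T)"
    using A unfolding shift_equivariant_def by blast
  then show ?thesis using t by simp
qed

section \<open>The linear core\<close>

text \<open>Linearity is the case \<open>\<tau> = 0\<close> of equivariance: coefficients 1 and 1
  give additivity, \<open>a\<close> and 0 give homogeneity.\<close>

lemma linear_core_in_Arr:
  assumes "T \<ge> 1"
  shows "linear_core T C\<^sub>1 \<kappa>\<^sub>1 \<kappa>\<^sub>2 k C\<^sub>2 Wax W ((), s) \<in> Arr Vect"
proof -
  let ?E = "encoder T C\<^sub>1 \<kappa>\<^sub>1 \<kappa>\<^sub>2 k C\<^sub>2 Wax W"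
  let ?I = "data_coords T s" and ?J = "feat_coords T (feature_count C\<^sub>2) s"
  have "linear_map real_field (coord_space ?I) (coord_space ?J)
      (\<lambda>x\<in>carrier (coord_space ?I). \<lambda>i\<in>?J. apply_blockwise ?E x i)"
  proof (rule linear_map_coord_spaceI)
    fix x y :: vec and j
    assume "x \<in> ?I \<rightarrow>\<^sub>E UNIV" "y \<in> ?I \<rightarrow>\<^sub>E UNIV" "j \<in> ?J"
    moreover from \<open>j \<in> ?J\<close> obtain ch c t where j: "j = Feat ch c t"
      and "ch \<in> channels s" and t: "t \<in> {0..<int T}"
      by (auto simp: feat_coords_def)
    \<comment> \<open>The term \<open>(t - 0) mod int T\<close> matches the shape of
      \<open>shift_equivariantD\<close>; it equals \<open>t\<close> because \<open>t\<close> is a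
      residue.\<close>
    moreover have "?E (\<lambda>t'. (\<lambda>i\<in>?I. x i + y i) (Data ch t')) c t =
        1 * ?E (\<lambda>t'. x (Data ch t')) c ((t - 0) mod int T) +
        1 * ?E (\<lambda>t'. y (Data ch t')) c ((t - 0) mod int T)"
      using \<open>ch \<in> channels s\<close>
      by (intro shift_equivariantD[OF shift_equivariant_encoder t]) simp_all
    ultimately show "(\<lambda>x\<in>carrier (coord_space ?I). \<lambda>i\<in>?J. apply_blockwise ?E x i)
          (\<lambda>i\<in>?I. x i + y i) j =
        (\<lambda>x\<in>carrier (coord_space ?I). \<lambda>i\<in>?J. apply_blockwise ?E x i) x j +
        (\<lambda>x\<in>carrier (coord_space ?I). \<lambda>i\<in>?J. apply_blockwise ?E x i) y j"
      by simp
  next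
    fix a and x :: vec and j
    assume "x \<in> ?I \<rightarrow>\<^sub>E UNIV" "j \<in> ?J"
    moreover from \<open>j \<in> ?J\<close> obtain ch c t where j: "j = Feat ch c t"
      and "ch \<in> channels s" and t: "t \<in> {0..<int T}"
      by (auto simp: feat_coords_def)
    moreover have "?E (\<lambda>t'. (\<lambda>i\<in>?I. a * x i) (Data ch t')) c t =
        a * ?E (\<lambda>t'. x (Data ch t')) c ((t - 0) mod int T) +
        0 * ?E (\<lambda>t'. x (Data ch t')) c ((t - 0) mod int T)"
      using \<open>ch \<in> channels s\<close>
      by (intro shift_equivariantD[OF shift_equivariant_encoder t]) simp_all
    ultimately show "(\<lambda>x\<in>carrier (coord_space ?I). \<lambda>i\<in>?J. apply_blockwise ?E x i)
          (\<lambda>i\<in>?I. a * x i) j =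
        a * (\<lambda>x\<in>carrier (coord_space ?I). \<lambda>i\<in>?J. apply_blockwise ?E x i) x j"
      by simp
  qed auto
  then show ?thesis
    using assms
    by (simp add: linear_core_def Vect_def Let_def coord_space_in_fd_spaces
        time_blocks.finite_coords[OF time_blocks_data_coords]
        time_blocks.finite_coords[OF time_blocks_feat_coords] del: coord_space_simps)
qed

text \<open>Both composites are compared coordinate by coordinate, where the claim is equivariance
  of one encoder row on one block.\<close>

lemma linear_core_natural:
  assumes T: "T \<ge> 1" and le: "node_le s t"
  shows "arr_map (feature_functor T (feature_count C\<^sub>2)) ((\<tau>, g), (s, t))
      \<cdot>\<^bsub>Vect\<^esub> linear_core T C\<^sub>1 \<kappa>\<^sub>1 \<kappa>\<^sub>2 k C\<^sub>2 Wax W ((), s) =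
    linear_core T C\<^sub>1 \<kappa>\<^sub>1 \<kappa>\<^sub>2 k C\<^sub>2 Wax W ((), t)
      \<cdot>\<^bsub>Vect\<^esub> arr_map (data_functor T) ((\<tau>, g), (s, t))"
proof -
  let ?E = "encoder T C\<^sub>1 \<kappa>\<^sub>1 \<kappa>\<^sub>2 k C\<^sub>2 Wax W"
  let ?I = "data_coords T" and ?J = "feat_coords T (feature_count C\<^sub>2)"
  let ?X = "\<lambda>x. \<lambda>i\<in>?I t. if i \<in> ?I s then g (coord_sensor i) * x (delay_coord T \<tau> i) else 0"
  interpret I: time_blocks T ?I by (rule time_blocks_data_coords[OF T])
  interpret J: time_blocks T ?J by (rule time_blocks_feat_coords[OF T])
  have *: "(if i \<in> ?J s then g (coord_sensor i) * apply_blockwise ?E x (delay_coord T \<tau> i) else 0) =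
      apply_blockwise ?E (?X x) i" if "i \<in> ?J t" for x i
  proof -
    from that obtain q \<alpha> c r where i: "i = Feat (q, \<alpha>) c r"
      and ch: "(q, \<alpha>) \<in> channels t" "c < feature_count C\<^sub>2" and r: "r \<in> {0..<int T}"
      by (auto simp: feat_coords_def)
    let ?x = "\<lambda>t'. x (Data (q, \<alpha>) t')"
    \<comment> \<open>The coefficient \<open>a\<close> is the gain on blocks of \<open>s\<close> and
      0 on blocks added by zero extension, so one instance with \<open>b = 0\<close> covers both
      cases.\<close>
    have "?E (\<lambda>t'. ?X x (Data (q, \<alpha>) t')) c r =
        (if (q, \<alpha>) \<in> channels s then g q else 0) * ?E ?x c ((r - \<tau>) mod int T) +
        0 * ?E ?x c ((r - \<tau>) mod int T)"
      using ch by (intro shift_equivariantD[OF shift_equivariant_encoder r])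
        (auto simp: data_coords_def)
    then show ?thesis
      using ch r by (auto simp: i feat_coords_def)
  qed
  let ?V = "carrier (coord_space (?I s))"
  have "compose ?V
      (\<lambda>y\<in>carrier (coord_space (?J s)). \<lambda>i\<in>?J t.
        if i \<in> ?J s then g (coord_sensor i) * y (delay_coord T \<tau> i) else 0)
      (\<lambda>x\<in>?V. \<lambda>i\<in>?J s. apply_blockwise ?E x i) =
    compose ?V (\<lambda>y\<in>carrier (coord_space (?I t)). \<lambda>i\<in>?J t. apply_blockwise ?E y i) (\<lambda>x\<in>?V. ?X x)"
    (is "compose ?V ?G ?F = compose ?V ?F' ?G'")
  \<comment> \<open>Both sides are extensional on \<open>?V\<close>, so it suffices to evaluate them
    there.\<close>
  proof (rule extensionalityI[OF compose_extensional compose_extensional])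
    fix x assume x: "x \<in> ?V"
    \<comment> \<open>The delayed coordinate stays in \<open>?J s\<close>, so the restricted inner
      function takes its proper value there.\<close>
    have "?G (?F x) = (\<lambda>i\<in>?J t. if i \<in> ?J s
        then g (coord_sensor i) * apply_blockwise ?E x (delay_coord T \<tau> i) else 0)"
      using x by (auto simp: J.delay_coord_mem_iff intro!: restrict_ext)
    also have "\<dots> = (\<lambda>i\<in>?J t. apply_blockwise ?E (?X x) i)"
      by (intro restrict_ext *)
    also have "\<dots> = ?F' (?G' x)"
      using x by simp
    finally show "compose ?V ?G ?F x = compose ?V ?F' ?G' x"
      using x by (simp only: compose_eq)
  qed
  then show ?thesis
    by (simp add: feature_functor_def data_functor_def I.arr_map_block_functor[OF le]
        J.arr_map_block_functor[OF le] linear_core_def Let_def Vect_def del: coord_space_simps)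
qed

lemma natural_transformation_linear_core:
  assumes "T \<ge> 1"
  shows "natural_transformation (sym_cat T) Vect (data_functor T)
    (feature_functor T (feature_count C\<^sub>2)) (linear_core T C\<^sub>1 \<kappa>\<^sub>1 \<kappa>\<^sub>2 k C\<^sub>2 Wax W)"
proof (intro natural_transformation.intro natural_transformation_axioms.intro)
  show "cat_functor (sym_cat T) Vect (data_functor T)"
    unfolding data_functor_def
    by (intro time_blocks.cat_functor_block_functor time_blocks_data_coords assms)
  show "cat_functor (sym_cat T) Vect (feature_functor T (feature_count C\<^sub>2))"
    unfolding feature_functor_def
    by (intro time_blocks.cat_functor_block_functor time_blocks_feat_coords assms)
next
  fix a :: "unit \<times> node"
  show "linear_core T C\<^sub>1 \<kappa>\<^sub>1 \<kappa>\<^sub>2 k C\<^sub>2 Wax W a \<in> Arr Vect"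
    using linear_core_in_Arr[OF assms] by (cases a) simp
  show "Dom Vect (linear_core T C\<^sub>1 \<kappa>\<^sub>1 \<kappa>\<^sub>2 k C\<^sub>2 Wax W a) = obj_map (data_functor T) a"
    and "Cod Vect (linear_core T C\<^sub>1 \<kappa>\<^sub>1 \<kappa>\<^sub>2 k C\<^sub>2 Wax W a) =
      obj_map (feature_functor T (feature_count C\<^sub>2)) a"
    by (simp_all add: linear_core_def Let_def Vect_def data_functor_def feature_functor_def
        block_functor_def split_beta del: coord_space_simps)
qed (auto simp: linear_core_natural[OF assms] sym_cat_simps)

text \<open>All taps are read at residues, where the restricted mean is the actual mean; the finite
  sum over taps then distributes over the sum and the factor 1/2.\<close>

lemma box_rows_sensor_mean:
  "box_rows N T k (sensor_mean N T H H') = sensor_mean N T (box_rows N T k H) (box_rows N T k H')"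
  by (simp add: box_rows_def sensor_mean_def box_smooth_def fun_eq_iff restrict_def
      sum.distrib add_divide_distrib flip: sum_divide_distrib)

theorem proposition3:
  fixes T C\<^sub>1 \<kappa>\<^sub>1 \<kappa>\<^sub>2 k :: nat and C\<^sub>2 :: "nat \<Rightarrow> nat"
    and Wax :: "nat \<Rightarrow> nat \<Rightarrow> real" and W :: "nat \<Rightarrow> nat \<Rightarrow> nat \<Rightarrow> nat \<Rightarrow> real"
  assumes "T \<ge> 1" "C\<^sub>1 \<ge> 1" "\<kappa>\<^sub>1 \<ge> 1" "\<kappa>\<^sub>2 \<ge> 1" "k \<ge> 1"
    and "C\<^sub>2 1 \<ge> 1" "C\<^sub>2 2 \<ge> 1" "C\<^sub>2 3 \<ge> 1"
  defines "X \<equiv> data_functor T"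
    and "Y \<equiv> feature_functor T (feature_count C\<^sub>2)"
    and "\<eta> \<equiv> linear_core T C\<^sub>1 \<kappa>\<^sub>1 \<kappa>\<^sub>2 k C\<^sub>2 Wax W"
  shows "(\<forall>\<tau> g s t. (\<tau>, g) \<in> carrier (integer_mod_group T \<times>\<times> gain_group) \<longrightarrow> node_le s t \<longrightarrow>
            arr_map Y ((\<tau>, g), (s, t)) \<cdot>\<^bsub>Vect\<^esub> \<eta> ((), s)
              = \<eta> ((), t) \<cdot>\<^bsub>Vect\<^esub> arr_map X ((\<tau>, g), (s, t)))
    \<and> natural_transformation (sym_cat T) Vect X Y \<eta>
    \<and> (\<forall>N\<ge>1. \<forall>H_ACC\<in>matrices N T. \<forall>H_GYR\<in>matrices N T.
          box_rows N T k (sensor_mean N T H_ACC H_GYR)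
            = sensor_mean N T (box_rows N T k H_ACC) (box_rows N T k H_GYR)
        \<and> time_mean N T (box_rows N T k (sensor_mean N T H_ACC H_GYR))
            = time_mean N T (sensor_mean N T (box_rows N T k H_ACC) (box_rows N T k H_GYR)))"
  using assms(1) unfolding X_def Y_def \<eta>_def
  \<comment> \<open>The time averages agree by applying \<open>time_mean\<close> to the equality of
    the smoothed matrices.\<close>
  by (intro conjI allI impI ballI linear_core_natural natural_transformation_linear_core
      box_rows_sensor_mean arg_cong[where f = "time_mean _ _"])

end
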